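(* Let $B=B'(p)\subseteq\mathbb{R}^S$ be an integral base-polyhedron given by an integer-valued supermodular function $p$. The output $z^*$ of the Fujishige-type decomposition algorithm (described in the context) applied to $B\cap\mathbb{Z}^S$ is a minimizer of the square-sum $W(x)=\sum_{s\in S}x(s)^2$ over the M-convex set $B\cap\mathbb{Z}^S$; equivalently, $z^*$ is a decreasingly minimal element of $B\cap\mathbb{Z}^S$.
   Context: $S$ is a finite non-empty set. For $x\in\mathbb{R}^S$ and $Z\subseteq S$, $\widetilde x(Z):=\sum_{s\in Z}x(s)$; $\chi_s$ is the unit vector of $s\in S$. A set-function $p:2^S\to\mathbb{Z}\cup\{-\infty\}$ with $p(\emptyset)=0$ is supermodular if $p(X)+p(Y)\le p(X\cap Y)+p(X\cup Y)$ for all $X,Y$ with finite $p$-values; $p(S)$ is assumed finite. $B'(p):=\{x\in\mathbb{R}^S:\widetilde x(S)=p(S),\ \widetilde x(Z)\ge p(Z)\text{ for every }Z\subset S\}$; the set $B\cap\mathbb{Z}^S$ is called an M-convex set. An element $m$ of a set $P$ of vectors is decreasingly minimal (dec-min) in $P$ if the vector of its components sorted in non-increasing order is lexicographically smallest among those of elements of $P$. For $S_+\subseteq S$, the restriction of $B$ to $S_+$ is $B'(p_+)$ on ground-set $S_+$, where $p_+(X):=p(X)$ for $X\subseteq S_+$. For $S_-\subseteq S$, the contraction of $B$ to $S_-$ is $B'(p_-)$ on ground-set $S_-$, where $p_-(X):=p(X\cup(S-S_-))-p(S-S_-)$ for $X\subseteq S_-$. Fujishige-type decomposition algorithm on $B\cap\mathbb{Z}^S$: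 1. Set $a:=\lfloor p(S)/|S|\rfloor$. 2. Find $z\in B\cap\mathbb{Z}^S$ such that for all $s,t\in S$: if $z(s)\le a$, $z(t)\ge a+1$ and $z(t)\ge z(s)+2$, then $z+\chi_s-\chi_t\notin B\cap\mathbb{Z}^S$. 3. Define $S_+:=\bigcup_{t\in S:\,z(t)\ge a+2}\{s\in S: z+\chi_s-\chi_t\in B\cap\mathbb{Z}^S\}$, $S_-:=\bigcup_{s\in S:\,z(s)\le a-1}\{t\in S: z+\chi_s-\chi_t\in B\cap\mathbb{Z}^S\}$, $S_0:=S-(S_+\cup S_-)$, and let $z^*(s):=z(s)$ for each $s\in S_0$. 4. If $S_+\ne\emptyset$, apply the algorithm recursively to the (integral points of the) restriction to $S_+$, which determines $z^*$ on $S_+$. If $S_-\ne\emptyset$, apply the algorithm recursively to the (integral points of the) contraction to $S_-$, which determines $z^*$ on $S_-$. 5. If both $S_+$ and $S_-$ are empty, stop. When the algorithm (with all its recursive calls) terminates, $z^*(s)$ is defined for all $s\in S$; this $z^*$ is the output. *)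

theory Defs
  imports Complex_Main "HOL-Library.FuncSet" "HOL-Library.Multiset" "HOL-Library.Extended_Real"
begin

text \<open>
  A vector of R^S is a function of type \<open>'a \<Rightarrow> real\<close> in \<open>extensional S\<close>. A set-function
  on the subsets of S is a function of type \<open>'a set \<Rightarrow> ereal\<close> of which only the values on
  subsets of S matter.
\<close>

definition int_supermodular :: "'a set \<Rightarrow> ('a set \<Rightarrow> ereal) \<Rightarrow> bool" where
  "int_supermodular S p \<longleftrightarrow>
     (\<forall>X\<subseteq>S. p X = -\<infinity> \<or> (\<exists>k::int. p X = ereal (real_of_int k))) \<and>
     p {} = 0 \<and> p S \<noteq> -\<infinity> \<and>
     (\<forall>X\<subseteq>S. \<forall>Y\<subseteq>S. p X \<noteq> -\<infinity> \<longrightarrow> p Y \<noteq> -\<infinity> \<longrightarrow>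
        p X + p Y \<le> p (X \<inter> Y) + p (X \<union> Y))"

definition base_polyhedron :: "'a set \<Rightarrow> ('a set \<Rightarrow> ereal) \<Rightarrow> ('a \<Rightarrow> real) set" where
  "base_polyhedron S p =
     {x \<in> extensional S. ereal (\<Sum>s\<in>S. x s) = p S \<and> (\<forall>Z. Z \<subset> S \<longrightarrow> ereal (\<Sum>s\<in>Z. x s) \<ge> p Z)}"

definition int_points :: "'a set \<Rightarrow> ('a \<Rightarrow> real) set \<Rightarrow> ('a \<Rightarrow> real) set" where
  "int_points S B = {x \<in> B. \<forall>s\<in>S. x s \<in> \<int>}"

definition square_sum :: "'a set \<Rightarrow> ('a \<Rightarrow> real) \<Rightarrow> real" where
  "square_sum S x = (\<Sum>s\<in>S. (x s)\<^sup>2)"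

definition sorted_desc :: "'a set \<Rightarrow> ('a \<Rightarrow> real) \<Rightarrow> real list" where
  "sorted_desc S x = rev (sorted_list_of_multiset (image_mset x (mset_set S)))"

definition dec_min :: "'a set \<Rightarrow> ('a \<Rightarrow> real) set \<Rightarrow> ('a \<Rightarrow> real) \<Rightarrow> bool" where
  "dec_min S P m \<longleftrightarrow>
     m \<in> P \<and> (\<forall>x\<in>P. ord_class.lexordp_eq (sorted_desc S m) (sorted_desc S x))"

text \<open>
  \<open>exchange z s t\<close> is z plus the unit vector of s minus the unit vector of t. For s and t in S
  it maps \<open>extensional S\<close> into itself.
\<close>

definition exchange :: "('a \<Rightarrow> real) \<Rightarrow> 'a \<Rightarrow> 'a \<Rightarrow> ('a \<Rightarrow> real)" where
  "exchange z s t = (\<lambda>u. z u + of_bool (u = s) - of_bool (u = t))"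

text \<open>
  The set-function of the contraction to T of the base-polyhedron with ground-set S. The
  set-function of the restriction to T is p itself, now used with ground-set T.
\<close>

definition contraction_fun :: "'a set \<Rightarrow> ('a set \<Rightarrow> ereal) \<Rightarrow> 'a set \<Rightarrow> ('a set \<Rightarrow> ereal)" where
  "contraction_fun S p T = (\<lambda>X. p (X \<union> (S - T)) - p (S - T))"

definition avg_floor :: "'a set \<Rightarrow> ('a set \<Rightarrow> ereal) \<Rightarrow> int" where
  "avg_floor S p = \<lfloor>real_of_ereal (p S) / real (card S)\<rfloor>"

definition locally_balanced :: "'a set \<Rightarrow> ('a \<Rightarrow> real) set \<Rightarrow> int \<Rightarrow> ('a \<Rightarrow> real) \<Rightarrow> bool" where
  "locally_balanced S M a z \<longleftrightarrow> z \<in> M \<and>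
     (\<forall>s\<in>S. \<forall>t\<in>S. z s \<le> of_int a \<longrightarrow> z t \<ge> of_int a + 1 \<longrightarrow> z t \<ge> z s + 2 \<longrightarrow> exchange z s t \<notin> M)"

definition S_plus :: "'a set \<Rightarrow> ('a \<Rightarrow> real) set \<Rightarrow> int \<Rightarrow> ('a \<Rightarrow> real) \<Rightarrow> 'a set" where
  "S_plus S M a z = (\<Union>t\<in>{t\<in>S. z t \<ge> of_int a + 2}. {s\<in>S. exchange z s t \<in> M})"

definition S_minus :: "'a set \<Rightarrow> ('a \<Rightarrow> real) set \<Rightarrow> int \<Rightarrow> ('a \<Rightarrow> real) \<Rightarrow> 'a set" where
  "S_minus S M a z = (\<Union>s\<in>{s\<in>S. z s \<le> of_int a - 1}. {t\<in>S. exchange z s t \<in> M})"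

text \<open>
  \<open>decomposition_output S p zs\<close> says that some terminating run of the algorithm on the integral
  points of the base-polyhedron of p returns zs. It is a relation because the choice of z in each
  call is free; being inductive, it only admits runs with finitely many recursive calls. The run
  stops when both premises with a recursive call are void.
\<close>

inductive decomposition_output :: "'a set \<Rightarrow> ('a set \<Rightarrow> ereal) \<Rightarrow> ('a \<Rightarrow> real) \<Rightarrow> bool" where
  decompose:
  "\<lbrakk> M = int_points S (base_polyhedron S p);
     a = avg_floor S p;
     locally_balanced S M a z;
     Sp = S_plus S M a z;
     Sm = S_minus S M a z;
     zs \<in> extensional S;
     \<forall>s \<in> S - (Sp \<union> Sm). zs s = z s;
     Sp \<noteq> {} \<longrightarrow> decomposition_output Sp p (restrict zs Sp);
     Sm \<noteq> {} \<longrightarrow> decomposition_output Sm (contraction_fun S p Sm) (restrict zs Sm) \<rbrakk>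
   \<Longrightarrow> decomposition_output S p zs"

end

theory Submission
  imports Defs
begin

text \<open>
  Everything is read off from the tight sets of an integral point z, the sets X with
  z(X) = p(X). They are closed under union and intersection, and \<open>exchange z s t\<close> is again an
  integral point exactly if every tight set that contains t contains s
  (\<open>exchange_in_M_convex_iff\<close>). So the s that can be combined with a given t form a tight set,
  and the t that can be combined with a given s form the complement of one.

  Optimality is a local property. Call a step from y to \<open>exchange y s t\<close> a tightening step if it
  keeps y in the M-convex set and y(t) \<open>\<ge>\<close> y(s) + 2. If y has no tightening step, then for every
  integer k the exchanges that decrease a value above k all take place in one tight set U on
  which y is at least k and outside of which it is at most k. Hence the sum of the excesses
  max 0 (y(s) - k) equals p(U) - k|U|, a lower bound for the excess sum of every other point
  (\<open>no_tightening_hinge_le\<close>). Thus y is majorized by every other point, so it minimizes every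
  symmetric separable convex function, the square-sum in particular, and it is decreasingly
  minimal (\<open>no_tightening_optimal\<close>). The excess sums also show that a lower or upper bound which
  holds for one integral point holds for every point without tightening step.

  It remains to see that the output has no tightening step. For the z chosen in a call, the sets
  \<open>S_plus\<close> and \<open>S - S_minus\<close> are tight and z is at least a + 1 on \<open>S_plus\<close>, at most a on
  \<open>S_minus\<close>, and a or a + 1 elsewhere (\<open>locally_balanced_decomposition\<close>). Integral points for
  which a set Q is tight are the same thing as pairs of an integral point of the restriction to Q
  and one of the contraction to S - Q, so the results of the recursive calls can be glued in.
  They have no tightening step, hence obey the bounds which z obeys on \<open>S_plus\<close> and
  \<open>S_minus\<close>. A step inside one of these sets is not tightening by induction. As every
  tight set containing t contains s, any other step either stays in the middle part, where the
  values differ by at most one, or gives to a part whose values are at least as large as those of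
  the part from which it takes, so it is not tightening either (\<open>combine_no_tightening\<close>).

  Runs exist because the M-convex set is not empty, a point of least square-sum may serve as z,
  and a is the average rounded down: if \<open>S_plus\<close> or \<open>S_minus\<close> were all of S, then the values of z
  would be too large or too small for their sum p(S).
\<close>

section \<open>Tight sets and exchanges\<close>

abbreviation M_convex :: "'a set \<Rightarrow> ('a set \<Rightarrow> ereal) \<Rightarrow> ('a \<Rightarrow> real) set" where
  "M_convex S p \<equiv> int_points S (base_polyhedron S p)"

definition tight :: "'a set \<Rightarrow> ('a set \<Rightarrow> ereal) \<Rightarrow> ('a \<Rightarrow> real) \<Rightarrow> 'a set \<Rightarrow> bool" where
  "tight S p x X \<longleftrightarrow> X \<subseteq> S \<and> p X = ereal (sum x X)"

definition no_tightening :: "'a set \<Rightarrow> ('a \<Rightarrow> real) set \<Rightarrow> ('a \<Rightarrow> real) \<Rightarrow> bool" where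
  "no_tightening S M y \<longleftrightarrow> (\<forall>s\<in>S. \<forall>t\<in>S. y t \<ge> y s + 2 \<longrightarrow> exchange y s t \<notin> M)"

lemma M_convex_iff:
  "x \<in> M_convex S p \<longleftrightarrow> x \<in> extensional S \<and> (\<forall>s\<in>S. x s \<in> \<int>) \<and>
     p S = ereal (sum x S) \<and> (\<forall>Z\<subseteq>S. p Z \<le> ereal (sum x Z))"
proof -
  have "(\<forall>Z\<subseteq>S. p Z \<le> ereal (sum x Z)) \<longleftrightarrow> p S \<le> ereal (sum x S) \<and> (\<forall>Z. Z \<subset> S \<longrightarrow> p Z \<le> ereal (sum x Z))"
    unfolding subset_iff_psubset_eq by blast
  then show ?thesis
    unfolding int_points_def base_polyhedron_def by (auto simp: eq_commute[of "ereal (sum x S)"])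
qed

lemma M_convex_le: "x \<in> M_convex S p \<Longrightarrow> Z \<subseteq> S \<Longrightarrow> p Z \<le> ereal (sum x Z)"
  by (simp add: M_convex_iff)

lemma tight_ground_set: "x \<in> M_convex S p \<Longrightarrow> tight S p x S"
  by (simp add: tight_def M_convex_iff)

lemma int_supermodular_values:
  assumes "int_supermodular S p" "X \<subseteq> S" "p X \<noteq> -\<infinity>"
  obtains k :: int where "p X = ereal (of_int k)"
  using assms unfolding int_supermodular_def by blast

lemma int_supermodular_ineq:
  assumes "int_supermodular S p" "X \<subseteq> S" "Y \<subseteq> S" "p X \<noteq> -\<infinity>" "p Y \<noteq> -\<infinity>"
  shows "p X + p Y \<le> p (X \<inter> Y) + p (X \<union> Y)"
  using assms unfolding int_supermodular_def by blast

text \<open>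
  The values of p lie below \<open>\<infinity>\<close>, so a summand \<open>-\<infinity>\<close> on the right of the supermodular
  inequality could not be compensated by the other one.
\<close>

lemma int_supermodular_finite_Int_Un:
  assumes sm: "int_supermodular S p" and "X \<subseteq> S" "Y \<subseteq> S" "p X \<noteq> -\<infinity>" "p Y \<noteq> -\<infinity>"
  shows "p (X \<inter> Y) \<noteq> -\<infinity>" "p (X \<union> Y) \<noteq> -\<infinity>"
proof -
  obtain i where i: "p X = ereal (of_int i)" using int_supermodular_values assms by blast
  obtain j where j: "p Y = ereal (of_int j)" using int_supermodular_values assms by blast
  have sub: "X \<inter> Y \<subseteq> S" "X \<union> Y \<subseteq> S" using assms by auto
  have le: "ereal (of_int i + of_int j) \<le> p (X \<inter> Y) + p (X \<union> Y)"
    using int_supermodular_ineq[OF assms] i j by simp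
  have npi: "p Z \<noteq> \<infinity>" if Z: "Z \<subseteq> S" for Z
  proof (cases "p Z = -\<infinity>")
    case False
    then obtain k where "p Z = ereal (of_int k)"
      by (rule int_supermodular_values[OF sm Z])
    then show ?thesis by simp
  qed simp
  show "p (X \<inter> Y) \<noteq> -\<infinity>" "p (X \<union> Y) \<noteq> -\<infinity>"
    using le npi[OF sub(1)] npi[OF sub(2)]
    by (cases "p (X \<inter> Y)"; cases "p (X \<union> Y)"; simp)+
qed

text \<open>
  Uncrossing: x(X) + x(Y) = p(X) + p(Y) is at most the sum of the two p-values of intersection
  and union, while x dominates p on both and is modular, so equality holds in both.
\<close>

lemma tight_Int_Un:
  assumes fin: "finite S" and sm: "int_supermodular S p" and x: "x \<in> M_convex S p"
    and X: "tight S p x X" and Y: "tight S p x Y"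
  shows "tight S p x (X \<inter> Y)" "tight S p x (X \<union> Y)"
proof -
  have sub: "X \<subseteq> S" "Y \<subseteq> S" "X \<inter> Y \<subseteq> S" "X \<union> Y \<subseteq> S"
    using X Y by (auto simp: tight_def)
  have pX: "p X = ereal (sum x X)" and pY: "p Y = ereal (sum x Y)"
    using X Y by (auto simp: tight_def)
  have fin': "p (X \<inter> Y) \<noteq> -\<infinity>" "p (X \<union> Y) \<noteq> -\<infinity>"
    using int_supermodular_finite_Int_Un[OF sm sub(1,2)] pX pY by auto
  obtain i where i: "p (X \<inter> Y) = ereal (of_int i)"
    using int_supermodular_values[OF sm sub(3) fin'(1)] .
  obtain j where j: "p (X \<union> Y) = ereal (of_int j)"
    using int_supermodular_values[OF sm sub(4) fin'(2)] .
  have "sum x X + sum x Y \<le> of_int i + of_int j"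
    using int_supermodular_ineq[OF sm sub(1,2)] pX pY i j by simp
  moreover have "of_int i \<le> sum x (X \<inter> Y)" "of_int j \<le> sum x (X \<union> Y)"
    using M_convex_le[OF x sub(3)] M_convex_le[OF x sub(4)] i j by auto
  moreover have "sum x (X \<union> Y) + sum x (X \<inter> Y) = sum x X + sum x Y"
    using sub fin by (intro sum.union_inter) (auto intro: finite_subset)
  ultimately show "tight S p x (X \<inter> Y)" "tight S p x (X \<union> Y)"
    using sub i j by (auto simp: tight_def)
qed

lemma tight_Union:
  assumes "finite S" "int_supermodular S p" "x \<in> M_convex S p"
    and "finite F" "\<And>X. X \<in> F \<Longrightarrow> tight S p x X"
  shows "tight S p x (\<Union>F)"
  using assms(4,5)
proof (induction F rule: finite_induct)
  case empty
  then show ?case using assms(2) by (simp add: tight_def int_supermodular_def zero_ereal_def)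
next
  case (insert X F)
  then show ?case using tight_Int_Un(2)[OF assms(1-3), of X "\<Union>F"] by simp
qed

text \<open>
  Intersecting with S gives the empty family its intended meaning as the ground set.
\<close>

lemma tight_Inter:
  assumes "finite S" "int_supermodular S p" "x \<in> M_convex S p"
    and "finite F" "\<And>X. X \<in> F \<Longrightarrow> tight S p x X"
  shows "tight S p x (S \<inter> \<Inter>F)"
  using assms(4,5)
proof (induction F rule: finite_induct)
  case empty
  then show ?case using tight_ground_set[OF assms(3)] by simp
next
  case (insert X F)
  have "S \<inter> \<Inter>(insert X F) = X \<inter> (S \<inter> \<Inter>F)" by auto
  then show ?case using insert tight_Int_Un(1)[OF assms(1-3), of X "S \<inter> \<Inter>F"] by simp
qed

lemma exchange_same [simp]: "exchange z s s = z"
  by (simp add: exchange_def)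

lemma sum_exchange:
  assumes "finite X"
  shows "sum (exchange z s t) X = sum z X + of_bool (s \<in> X) - of_bool (t \<in> X)"
  using assms by (simp add: exchange_def sum.distrib sum_subtractf of_bool_def sum.delta)

text \<open>
  The exchange lowers only the sums over sets that contain t but not s, and lowers these by one.
  By integrality such a set has slack at least one unless it is tight.
\<close>

lemma exchange_in_M_convex_iff:
  assumes fin: "finite S" and sm: "int_supermodular S p" and z: "z \<in> M_convex S p"
    and s: "s \<in> S" and t: "t \<in> S"
  shows "exchange z s t \<in> M_convex S p \<longleftrightarrow> (\<forall>X. tight S p z X \<longrightarrow> t \<in> X \<longrightarrow> s \<in> X)"
proof
  assume e: "exchange z s t \<in> M_convex S p"
  show "\<forall>X. tight S p z X \<longrightarrow> t \<in> X \<longrightarrow> s \<in> X"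
  proof (intro allI impI, rule ccontr)
    fix X assume X: "tight S p z X" "t \<in> X" "s \<notin> X"
    then have "X \<subseteq> S" "finite X" using fin finite_subset by (auto simp: tight_def)
    then have "p X \<le> ereal (sum (exchange z s t) X)"
      using e by (auto simp: M_convex_iff)
    then show False using X \<open>finite X\<close> by (simp add: sum_exchange tight_def)
  qed
next
  assume *: "\<forall>X. tight S p z X \<longrightarrow> t \<in> X \<longrightarrow> s \<in> X"
  have "p X \<le> ereal (sum (exchange z s t) X)" if X: "X \<subseteq> S" for X
  proof (cases "t \<in> X \<and> s \<notin> X \<and> p X \<noteq> -\<infinity>")
    case True
    then obtain k where k: "p X = ereal (of_int k)"
      using int_supermodular_values[OF sm X] by blast
    have "sum z X \<in> \<int>" using z X by (intro Ints_sum) (auto simp: M_convex_iff)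
    then obtain m where m: "sum z X = of_int m" by (auto elim: Ints_cases)
    have "p X \<le> ereal (sum z X)" using z X by (auto simp: M_convex_iff)
    moreover have "p X \<noteq> ereal (sum z X)" using * True X by (auto simp: tight_def)
    ultimately have "k < m" using k m by auto
    then show ?thesis
      using True k m finite_subset[OF X fin] by (simp add: sum_exchange)
  next
    case False
    have "p X \<le> ereal (sum z X)" using z X by (auto simp: M_convex_iff)
    then show ?thesis
      using False finite_subset[OF X fin]
      by (cases "p X = -\<infinity>") (auto simp: sum_exchange of_bool_def intro: order_trans)
  qed
  moreover have "exchange z s t \<in> extensional S"
    using z s t by (auto simp: exchange_def extensional_def M_convex_iff)
  moreover have "exchange z s t u \<in> \<int>" if "u \<in> S" for u
    using z that by (auto simp: exchange_def M_convex_iff)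
  ultimately show "exchange z s t \<in> M_convex S p"
    using z s t fin by (simp add: M_convex_iff sum_exchange)
qed

text \<open>
  The set below is the smallest tight set containing t.
\<close>

lemma tight_exchange_sources:
  assumes "finite S" "int_supermodular S p" "z \<in> M_convex S p" "t \<in> S"
  shows "tight S p z {s\<in>S. exchange z s t \<in> M_convex S p}"
proof -
  have "{s\<in>S. exchange z s t \<in> M_convex S p} = S \<inter> \<Inter>{X. tight S p z X \<and> t \<in> X}"
    using exchange_in_M_convex_iff[OF assms(1-3) _ assms(4)] by auto
  moreover have "finite {X. tight S p z X \<and> t \<in> X}"
    by (rule finite_subset[of _ "Pow S"]) (use assms(1) in \<open>auto simp: tight_def\<close>)
  ultimately show ?thesis by (simp only:) (rule tight_Inter[OF assms(1-3)], auto)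
qed

text \<open>
  The set below is the largest tight set avoiding s.
\<close>

lemma tight_exchange_targets:
  assumes "finite S" "int_supermodular S p" "z \<in> M_convex S p" "s \<in> S"
  shows "tight S p z (S - {t\<in>S. exchange z s t \<in> M_convex S p})"
proof -
  have "S - {t\<in>S. exchange z s t \<in> M_convex S p} = \<Union>{X. tight S p z X \<and> s \<notin> X}"
    using exchange_in_M_convex_iff[OF assms(1-4)] by (auto simp: tight_def)
  moreover have "finite {X. tight S p z X \<and> s \<notin> X}"
    by (rule finite_subset[of _ "Pow S"]) (use assms(1) in \<open>auto simp: tight_def\<close>)
  ultimately show ?thesis by (simp only:) (rule tight_Union[OF assms(1-3)], auto)
qed

section \<open>Optimality of vectors without tightening step\<close>

lemma Ints_less_imp_add_one_le:
  fixes x y :: real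
  assumes "x \<in> \<int>" "y \<in> \<int>" "x < y"
  shows "x + 1 \<le> y"
  using assms by (auto elim!: Ints_cases)

text \<open>
  Two vectors of equal sum are compared in the majorization order by their excesses over all
  thresholds k. The union U of the smallest tight sets of the t with y(t) \<open>\<ge>\<close> k + 1 certifies
  that y has the least excess over k: y is at least k on U, since a smaller value there would
  yield a tightening step, and a tight set is one on which no other point has a smaller sum.
\<close>

lemma no_tightening_hinge_le:
  assumes fin: "finite S" and sm: "int_supermodular S p"
    and y: "y \<in> M_convex S p" and nt: "no_tightening S (M_convex S p) y"
    and x: "x \<in> M_convex S p"
  shows "(\<Sum>s\<in>S. max 0 (y s - of_int k)) \<le> (\<Sum>s\<in>S. max 0 (x s - of_int k))"
proof -
  define U where "U = (\<Union>t\<in>{t\<in>S. y t \<ge> of_int k + 1}. {s\<in>S. exchange y s t \<in> M_convex S p})"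
  have U: "tight S p y U"
    unfolding U_def using tight_exchange_sources[OF fin sm y] fin
    by (intro tight_Union[OF fin sm y]) auto
  then have US: "U \<subseteq> S" by (simp add: tight_def)
  have yZ: "y s \<in> \<int>" if "s \<in> S" for s using y that by (simp add: M_convex_iff)
  have inU: "y s \<ge> of_int k" if "s \<in> U" for s
  proof -
    from that obtain t where t: "t \<in> S" "y t \<ge> of_int k + 1" "s \<in> S" "exchange y s t \<in> M_convex S p"
      by (auto simp: U_def)
    then have "y t < y s + 2" using nt by (force simp: no_tightening_def)
    then have "y t + 1 \<le> y s + 2" using t yZ by (intro Ints_less_imp_add_one_le) auto
    then show ?thesis using t by simp
  qed
  have outU: "y s \<le> of_int k" if "s \<in> S" "s \<notin> U" for s
  proof (rule ccontr)
    assume "\<not> y s \<le> of_int k"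
    then have "of_int k + 1 \<le> y s" using that yZ by (intro Ints_less_imp_add_one_le) auto
    then show False using that y by (force simp: U_def)
  qed
  have "(\<Sum>s\<in>S. max 0 (y s - of_int k)) = (\<Sum>s\<in>U. max 0 (y s - of_int k))"
    using fin US outU by (intro sum.mono_neutral_right) auto
  also have "\<dots> = (\<Sum>s\<in>U. y s - of_int k)"
    using inU by (intro sum.cong) auto
  also have "\<dots> = sum y U - (\<Sum>s\<in>U. of_int k)" by (simp only: sum_subtractf)
  also have "\<dots> \<le> sum x U - (\<Sum>s\<in>U. of_int k)"
    using U x US by (auto simp: tight_def M_convex_iff)
  also have "\<dots> = (\<Sum>s\<in>U. x s - of_int k)" by (simp only: sum_subtractf)
  also have "\<dots> \<le> (\<Sum>s\<in>U. max 0 (x s - of_int k))" by (intro sum_mono) auto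
  also have "\<dots> \<le> (\<Sum>s\<in>S. max 0 (x s - of_int k))"
    using fin US by (intro sum_mono2) auto
  finally show ?thesis .
qed

text \<open>
  If a point x lies below k, its excess over k vanishes, hence so does that of y.
\<close>

lemma no_tightening_upper_bound:
  assumes fin: "finite S" and sm: "int_supermodular S p"
    and y: "y \<in> M_convex S p" and nt: "no_tightening S (M_convex S p) y"
    and x: "x \<in> M_convex S p" and le: "\<And>s. s \<in> S \<Longrightarrow> x s \<le> of_int k" and t: "t \<in> S"
  shows "y t \<le> of_int k"
proof -
  have "max 0 (y t - of_int k) \<le> (\<Sum>s\<in>S. max 0 (y s - of_int k))"
    using fin t by (intro member_le_sum) auto
  also have "\<dots> \<le> (\<Sum>s\<in>S. max 0 (x s - of_int k))"
    by (rule no_tightening_hinge_le[OF fin sm y nt x])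
  also have "\<dots> = 0" using le by (intro sum.neutral) auto
  finally show ?thesis by simp
qed

text \<open>
  As all points have the same sum, comparing excesses over k is the same as comparing deficits
  below k, and x has no deficit.
\<close>

lemma no_tightening_lower_bound:
  assumes fin: "finite S" and sm: "int_supermodular S p"
    and y: "y \<in> M_convex S p" and nt: "no_tightening S (M_convex S p) y"
    and x: "x \<in> M_convex S p" and ge: "\<And>s. s \<in> S \<Longrightarrow> of_int k \<le> x s" and t: "t \<in> S"
  shows "of_int k \<le> y t"
proof -
  \<comment> \<open>Summation of max 0 (-u) = max 0 u - u with u = w s - k.\<close>
  have reflect: "(\<Sum>s\<in>S. max 0 (of_int k - w s)) = (\<Sum>s\<in>S. max 0 (w s - of_int k)) -
      (sum w S - (\<Sum>s\<in>S. of_int k))" for w :: "'a \<Rightarrow> real"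
    unfolding sum_subtractf[symmetric] by (intro sum.cong) auto
  have "max 0 (of_int k - y t) \<le> (\<Sum>s\<in>S. max 0 (of_int k - y s))"
    using fin t by (intro member_le_sum) auto
  also have "\<dots> \<le> (\<Sum>s\<in>S. max 0 (of_int k - x s))"
    using no_tightening_hinge_le[OF fin sm y nt x, of k] x y
    unfolding reflect by (simp add: M_convex_iff)
  also have "\<dots> = 0" using ge by (intro sum.neutral) auto
  finally show ?thesis by simp
qed

text \<open>
  The second difference of the square function is the constant 2, so on the integers from L to
  L + D it is the line through its values at L and L + 1 plus twice the sum of the hinge functions with a kink
  at the integers above L.
\<close>

lemma square_eq_hinge_sum:
  fixes L :: int and x :: real
  assumes "x = of_int (L + int d)" "d \<le> D"
  shows "x\<^sup>2 = (of_int L)\<^sup>2 + (2 * of_int L + 1) * (x - of_int L)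
    + 2 * (\<Sum>j\<in>{1..D}. max 0 (x - of_int (L + int j)))"
proof -
  have "(\<Sum>j\<in>{1..D}. max 0 (x - of_int (L + int j))) = (\<Sum>j\<in>{1..d}. max 0 (x - of_int (L + int j)))"
    using assms by (intro sum.mono_neutral_right) auto
  also have "\<dots> = (\<Sum>j\<in>{1..d}. real d - real j)"
    using assms by (intro sum.cong) auto
  also have "\<dots> = real d * (real d - 1) / 2"
    by (induction d) (auto simp: sum_subtractf field_simps)
  finally show ?thesis using assms(1) by (simp add: power2_eq_square algebra_simps)
qed

text \<open>
  This is the square-sum case of the fact that majorization is preserved by separable convex
  functions: after expanding the squares into hinge functions, the linear parts of the two
  square-sums agree and the hinge parts are compared by assumption.
\<close>

lemma hinge_le_imp_square_sum_le:
  assumes fin: "finite S" and x: "\<And>s. s \<in> S \<Longrightarrow> x s \<in> \<int>" and y: "\<And>s. s \<in> S \<Longrightarrow> y s \<in> \<int>"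
    and eq: "sum y S = sum x S"
    and hinge: "\<And>k::int. (\<Sum>s\<in>S. max 0 (y s - of_int k)) \<le> (\<Sum>s\<in>S. max 0 (x s - of_int k))"
  shows "square_sum S y \<le> square_sum S x"
proof -
  \<comment> \<open>All values of x and y lie between -A and A, so the expansion starts at L = -A.\<close>
  define A where "A = (\<Sum>s\<in>S. \<lceil>\<bar>x s\<bar>\<rceil> + \<lceil>\<bar>y s\<bar>\<rceil>)"
  have A: "\<bar>x s\<bar> \<le> of_int A \<and> \<bar>y s\<bar> \<le> of_int A" if "s \<in> S" for s
  proof -
    have "\<lceil>\<bar>x s\<bar>\<rceil> + \<lceil>\<bar>y s\<bar>\<rceil> \<le> A"
      unfolding A_def using fin that by (intro member_le_sum) auto
    moreover have "0 \<le> \<lceil>\<bar>x s\<bar>\<rceil>" "0 \<le> \<lceil>\<bar>y s\<bar>\<rceil>" by linarith+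
    ultimately show ?thesis by linarith
  qed
  define D where "D = nat (2 * A)"
  have expand: "square_sum S w = (\<Sum>s\<in>S. (of_int (-A))\<^sup>2)
      + (2 * of_int (-A) + 1) * (sum w S - (\<Sum>s\<in>S. of_int (-A)))
      + 2 * (\<Sum>j\<in>{1..D}. \<Sum>s\<in>S. max 0 (w s - of_int (-A + int j)))"
    if w: "\<And>s. s \<in> S \<Longrightarrow> w s \<in> \<int> \<and> \<bar>w s\<bar> \<le> of_int A" for w
  proof -
    have "square_sum S w = (\<Sum>s\<in>S. (of_int (-A))\<^sup>2 + (2 * of_int (-A) + 1) * (w s - of_int (-A))
      + 2 * (\<Sum>j\<in>{1..D}. max 0 (w s - of_int (-A + int j))))"
      unfolding square_sum_def
    proof (rule sum.cong[OF refl])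
      fix s assume s: "s \<in> S"
      obtain m where m: "w s = of_int m" using w[OF s] by (auto elim: Ints_cases)
      have mA: "\<bar>m\<bar> \<le> A" using w[OF s] m by linarith
      show "(w s)\<^sup>2 = (of_int (-A))\<^sup>2 + (2 * of_int (-A) + 1) * (w s - of_int (-A))
        + 2 * (\<Sum>j\<in>{1..D}. max 0 (w s - of_int (-A + int j)))"
        by (rule square_eq_hinge_sum[where d = "nat (m + A)"]) (use mA m in \<open>auto simp: D_def\<close>)
    qed
    then show ?thesis
      by (simp only: sum.distrib sum_distrib_left[symmetric] sum_subtractf sum.swap[of _ "{1..D}" S])
  qed
  have "(\<Sum>j\<in>{1..D}. \<Sum>s\<in>S. max 0 (y s - of_int (-A + int j)))
      \<le> (\<Sum>j\<in>{1..D}. \<Sum>s\<in>S. max 0 (x s - of_int (-A + int j)))"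
    by (intro sum_mono hinge)
  then show ?thesis using expand[of x] expand[of y] A x y eq by simp
qed

lemma sum_eq_sum_list_sorted_desc:
  assumes "finite S"
  shows "(\<Sum>s\<in>S. f (x s)) = sum_list (map f (sorted_desc S x))"
proof -
  have "sum_list (map f (sorted_desc S x)) = sum_mset (mset (map f (sorted_desc S x)))"
    by (simp only: sum_mset_sum_list)
  also have "\<dots> = sum_mset (image_mset (\<lambda>s. f (x s)) (mset_set S))"
    by (simp add: sorted_desc_def multiset.map_comp comp_def)
  finally show ?thesis by (simp add: sum_unfold_sum_mset)
qed

text \<open>
  At the first position at which the sorted vectors differ, take the entry of x as threshold. No
  later entry of x exceeds it, so if it were the smaller of the two entries, the excess of y
  would be larger than that of x.
\<close>

lemma hinge_le_imp_sorted_desc_le: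
  assumes fin: "finite S" and x: "\<And>s. s \<in> S \<Longrightarrow> x s \<in> \<int>"
    and hinge: "\<And>k::int. (\<Sum>s\<in>S. max 0 (y s - of_int k)) \<le> (\<Sum>s\<in>S. max 0 (x s - of_int k))"
  shows "ord_class.lexordp_eq (sorted_desc S y) (sorted_desc S x)"
proof (rule ccontr)
  let ?X = "sorted_desc S x" and ?Y = "sorted_desc S y"
  assume "\<not> ord_class.lexordp_eq ?Y ?X"
  then have "ord_class.lexordp ?X ?Y" 
    using lexordp_linear[of ?X ?Y] by (auto simp: lexordp_eq_conv_lexord)
  moreover have len: "length ?X = length ?Y"
    by (simp add: sorted_desc_def flip: size_mset)
  ultimately obtain us a b vs ws where X: "?X = us @ a # vs" and Y: "?Y = us @ b # ws" and ab: "a < b"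
    unfolding lexordp_iff by fastforce
  have "set ?X = x ` S" using fin by (simp add: sorted_desc_def flip: set_mset_mset)
  then have "a \<in> \<int>" using X x by (metis image_iff in_set_conv_decomp)
  then obtain k where k: "a = of_int k" by (auto elim: Ints_cases)
  have "sorted_wrt (\<ge>) ?X"
    by (simp add: sorted_desc_def sorted_wrt_rev)
  then have le: "\<forall>v\<in>set vs. v \<le> a" using X by (simp add: sorted_wrt_append)
  let ?h = "\<lambda>v::real. max 0 (v - of_int k)"
  have "map ?h vs = map (\<lambda>_. 0) vs" using le k by auto
  then have "sum_list (map ?h vs) = 0" by (simp only: sum_list_0)
  then have "sum_list (map ?h ?X) = sum_list (map ?h us)" using X k by simp
  moreover have "sum_list (map ?h ?Y) = sum_list (map ?h us) + (b - a) + sum_list (map ?h ws)"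
    using Y k ab by simp
  moreover have "sum_list (map ?h ws) \<ge> 0" by (intro sum_list_nonneg) auto
  ultimately have "sum_list (map ?h ?X) < sum_list (map ?h ?Y)" using ab by simp
  then show False
    using hinge[of k] sum_eq_sum_list_sorted_desc[OF fin, of ?h] by simp
qed

lemma no_tightening_optimal:
  assumes fin: "finite S" and sm: "int_supermodular S p"
    and y: "y \<in> M_convex S p" and nt: "no_tightening S (M_convex S p) y"
  shows "is_arg_min (square_sum S) (\<lambda>x. x \<in> M_convex S p) y"
    and "dec_min S (M_convex S p) y"
proof -
  have "square_sum S y \<le> square_sum S x" if x: "x \<in> M_convex S p" for x
    using no_tightening_hinge_le[OF fin sm y nt x] x y
    by (intro hinge_le_imp_square_sum_le[OF fin]) (auto simp: M_convex_iff)
  then show "is_arg_min (square_sum S) (\<lambda>x. x \<in> M_convex S p) y"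
    using y by (force simp: is_arg_min_def)
  have "ord_class.lexordp_eq (sorted_desc S y) (sorted_desc S x)" if x: "x \<in> M_convex S p" for x
    using no_tightening_hinge_le[OF fin sm y nt x] x
    by (intro hinge_le_imp_sorted_desc_le[OF fin]) (auto simp: M_convex_iff)
  then show "dec_min S (M_convex S p) y"
    using y by (simp add: dec_min_def)
qed

section \<open>Splitting along a tight set\<close>

lemma int_supermodular_restriction:
  assumes "int_supermodular S p" "Q \<subseteq> S" "p Q \<noteq> -\<infinity>"
  shows "int_supermodular Q p"
  using assms unfolding int_supermodular_def by (meson order_trans)

lemma int_supermodular_contraction:
  assumes sm: "int_supermodular S p" and Q: "Q \<subseteq> S" and pQ: "p Q \<noteq> -\<infinity>"
  shows "int_supermodular (S - Q) (contraction_fun S p (S - Q))"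
proof -
  obtain q where q: "p Q = ereal (of_int q)" using int_supermodular_values[OF sm Q pQ] .
  have SQ: "S - (S - Q) = Q" using Q by auto
  have c: "contraction_fun S p (S - Q) X = p (X \<union> Q) - ereal (of_int q)" for X
    by (simp add: contraction_fun_def SQ q)
  have fin_iff: "p X - ereal (of_int q) = -\<infinity> \<longleftrightarrow> p X = -\<infinity>" for X
    by (cases "p X") auto
  have "p (X \<union> Q) - ereal (of_int q) + (p (Y \<union> Q) - ereal (of_int q))
      \<le> p ((X \<inter> Y) \<union> Q) - ereal (of_int q) + (p ((X \<union> Y) \<union> Q) - ereal (of_int q))"
    if "X \<subseteq> S - Q" "Y \<subseteq> S - Q" "p (X \<union> Q) \<noteq> -\<infinity>" "p (Y \<union> Q) \<noteq> -\<infinity>" for X Y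
  proof -
    have "(X \<union> Q) \<inter> (Y \<union> Q) = (X \<inter> Y) \<union> Q" "(X \<union> Q) \<union> (Y \<union> Q) = (X \<union> Y) \<union> Q" by auto
    moreover have "X \<union> Q \<subseteq> S" "Y \<union> Q \<subseteq> S" using that Q by auto
    ultimately have "p (X \<union> Q) + p (Y \<union> Q) \<le> p ((X \<inter> Y) \<union> Q) + p ((X \<union> Y) \<union> Q)"
      using int_supermodular_ineq[OF sm, of "X \<union> Q" "Y \<union> Q"] that by simp
    then show ?thesis
      by (cases "p (X \<union> Q)"; cases "p (Y \<union> Q)"; cases "p ((X \<inter> Y) \<union> Q)"; cases "p ((X \<union> Y) \<union> Q)") auto
  qed
  moreover have "p (X \<union> Q) - ereal (of_int q) = -\<infinity> \<or> (\<exists>k::int. p (X \<union> Q) - ereal (of_int q) = ereal (of_int k))"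
    if X: "X \<subseteq> S - Q" for X
  proof (cases "p (X \<union> Q) = -\<infinity>")
    case False
    moreover have "X \<union> Q \<subseteq> S" using X Q by auto
    ultimately obtain k where "p (X \<union> Q) = ereal (of_int k)"
      using int_supermodular_values[OF sm] by blast
    then have "p (X \<union> Q) - ereal (of_int q) = ereal (of_int (k - q))" by simp
    then show ?thesis by blast
  qed simp
  moreover have "S - Q \<union> Q = S" using Q by auto
  moreover have "p S \<noteq> -\<infinity>" using sm by (simp add: int_supermodular_def)
  ultimately show ?thesis
    unfolding int_supermodular_def c fin_iff using q by (simp add: zero_ereal_def)
qed

text \<open>
  The following three lemmas say that an integral point of the M-convex set for which Q is tight
  is the same as a pair of integral points of the restriction to Q and of the contraction to the
  rest.
\<close>

lemma M_convex_restriction: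
  assumes x: "x \<in> M_convex S p" and Q: "tight S p x Q"
  shows "restrict x Q \<in> M_convex Q p"
proof -
  have "sum (restrict x Q) Z = sum x Z" if "Z \<subseteq> Q" for Z
    using that by (intro sum.cong) auto
  then show ?thesis using assms unfolding M_convex_iff tight_def by auto
qed

lemma M_convex_contraction:
  assumes fin: "finite S" and x: "x \<in> M_convex S p" and Q: "tight S p x Q"
  shows "restrict x (S - Q) \<in> M_convex (S - Q) (contraction_fun S p (S - Q))"
proof -
  have QS: "Q \<subseteq> S" and pQ: "p Q = ereal (sum x Q)" using Q by (auto simp: tight_def)
  have SQ: "S - (S - Q) = Q" "S \<union> Q = S" using QS by auto
  have r: "sum (restrict x (S - Q)) Z = sum x Z" if "Z \<subseteq> S - Q" for Z
    using that by (intro sum.cong) auto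
  have u: "sum x (Z \<union> Q) = sum x Z + sum x Q" if "Z \<subseteq> S - Q" for Z
    using that fin QS by (intro sum.union_disjoint) (auto intro: finite_subset)
  have "p (Z \<union> Q) - ereal (sum x Q) \<le> ereal (sum x Z)" if "Z \<subseteq> S - Q" for Z
  proof -
    have "Z \<union> Q \<subseteq> S" using that QS by auto
    then have "p (Z \<union> Q) \<le> ereal (sum x Z + sum x Q)"
      using M_convex_le[OF x] u[OF that] by metis
    then show ?thesis by (cases "p (Z \<union> Q)") auto
  qed
  moreover have "p S - ereal (sum x Q) = ereal (sum x (S - Q))"
    using x u[OF order_refl] SQ by (simp add: M_convex_iff)
  ultimately show ?thesis
    using x by (simp add: M_convex_iff contraction_fun_def SQ pQ r restrict_apply' del: restrict_apply)
qed

text \<open>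
  Supermodularity for Z and Q gives p(Z) \<open>\<le>\<close> p(Z \<open>\<inter>\<close> Q) + (p(Z \<open>\<union>\<close> Q) - p(Q)), and the
  two terms are bounded by the sums of x over the parts of Z inside and outside of Q.
\<close>

lemma M_convex_glue:
  assumes fin: "finite S" and sm: "int_supermodular S p" and QS: "Q \<subseteq> S" and pQ: "p Q \<noteq> -\<infinity>"
    and ext: "x \<in> extensional S"
    and xQ: "restrict x Q \<in> M_convex Q p"
    and xN: "restrict x (S - Q) \<in> M_convex (S - Q) (contraction_fun S p (S - Q))"
  shows "x \<in> M_convex S p" "tight S p x Q"
proof -
  obtain q where q: "p Q = ereal (of_int q)" using int_supermodular_values[OF sm QS pQ] .
  have SQ: "S - (S - Q) = Q" "S \<union> Q = S" using QS by auto
  have rQ: "sum (restrict x Q) Z = sum x Z" if "Z \<subseteq> Q" for Z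
    using that by (intro sum.cong) auto
  have rN: "sum (restrict x (S - Q)) Z = sum x Z" if "Z \<subseteq> S - Q" for Z
    using that by (intro sum.cong) auto
  show tight: "tight S p x Q" using xQ rQ QS by (simp add: M_convex_iff tight_def)
  then have qsum: "of_int q = sum x Q" using q by (simp add: tight_def)
  have "p S - ereal (of_int q) = ereal (sum x (S - Q))"
    using xN rN by (simp add: M_convex_iff contraction_fun_def SQ q)
  then have "p S = ereal (sum x (S - Q) + sum x Q)"
    using qsum by (cases "p S") auto
  moreover have "sum x (S - Q) + sum x Q = sum x S"
    using sum.subset_diff[OF QS fin, of x] by simp
  moreover have "p Z \<le> ereal (sum x Z)" if Z: "Z \<subseteq> S" for Z
  proof (cases "p Z = -\<infinity>")
    case False
    have "p Z + p Q \<le> p (Z \<inter> Q) + p (Z \<union> Q)"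
      by (rule int_supermodular_ineq[OF sm Z QS False pQ])
    moreover have "p (Z \<inter> Q) \<le> ereal (sum x (Z \<inter> Q))"
      using xQ rQ by (simp add: M_convex_iff)
    moreover have "p (Z \<union> Q) - ereal (of_int q) \<le> ereal (sum x (Z - Q))"
    proof -
      have "Z - Q \<subseteq> S - Q" using Z by auto
      then have "contraction_fun S p (S - Q) (Z - Q) \<le> ereal (sum x (Z - Q))"
        using xN rN by (simp add: M_convex_iff)
      then show ?thesis by (simp add: contraction_fun_def SQ q)
    qed
    moreover have "sum x (Z - Q) + sum x (Z \<inter> Q) = sum x Z"
      using sum.Int_Diff[of Z x Q] finite_subset[OF Z fin] by simp
    ultimately show ?thesis
      using q by (cases "p Z"; cases "p (Z \<inter> Q)"; cases "p (Z \<union> Q)") auto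
  qed simp
  moreover have "x s \<in> \<int>" if "s \<in> S" for s
    using xQ xN that by (cases "s \<in> Q") (auto simp: M_convex_iff)
  ultimately show "x \<in> M_convex S p" using ext by (simp add: M_convex_iff)
qed

text \<open>
  As p may take the value \<open>-\<infinity>\<close>, the greedy algorithm does not apply directly. Instead the
  ground set is cut along a proper non-empty subset of finite p-value. When none is left, the total
  sum is the only constraint.
\<close>

lemma M_convex_nonempty:
  assumes "finite S" "int_supermodular S p"
  shows "M_convex S p \<noteq> {}"
  using assms
proof (induction "card S" arbitrary: S p rule: less_induct)
  case less
  note fin = \<open>finite S\<close> and sm = \<open>int_supermodular S p\<close>
  show ?case
  proof (cases "\<exists>Q. Q \<subset> S \<and> Q \<noteq> {} \<and> p Q \<noteq> -\<infinity>")
    case True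
    then obtain Q where Q: "Q \<subset> S" "Q \<noteq> {}" "p Q \<noteq> -\<infinity>" by blast
    then have QS: "Q \<subseteq> S" "finite Q" using fin finite_subset by auto
    have "M_convex Q p \<noteq> {}"
      using less.hyps[OF psubset_card_mono[OF fin Q(1)] QS(2)]
        int_supermodular_restriction[OF sm QS(1) Q(3)] by blast
    then obtain y where y: "y \<in> M_convex Q p" by blast
    have "card (S - Q) < card S" using Q QS fin by (intro psubset_card_mono) auto
    then have "M_convex (S - Q) (contraction_fun S p (S - Q)) \<noteq> {}"
      using less.hyps[of "S - Q"] fin int_supermodular_contraction[OF sm QS(1) Q(3)] by blast
    then obtain z where z: "z \<in> M_convex (S - Q) (contraction_fun S p (S - Q))" by blast
    define x where "x = (\<lambda>s. if s \<in> Q then y s else z s)"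
    have "restrict x Q = y" "restrict x (S - Q) = z" "x \<in> extensional S"
      using y z QS by (auto simp: x_def M_convex_iff extensional_def fun_eq_iff)
    then have "x \<in> M_convex S p"
      using M_convex_glue(1)[OF fin sm QS(1) Q(3)] y z by simp
    then show ?thesis by blast
  next
    case False
    have "p S \<noteq> -\<infinity>" using sm by (simp add: int_supermodular_def)
    then obtain k where k: "p S = ereal (of_int k)"
      using int_supermodular_values[OF sm order_refl] by blast
    have p0: "p {} = 0" using sm by (simp add: int_supermodular_def)
    obtain x :: "'a \<Rightarrow> real" where x: "x \<in> extensional S" "\<forall>s\<in>S. x s \<in> \<int>" "sum x S = of_int k"
    proof (cases "S = {}")
      case True
      then show ?thesis using that[of "\<lambda>_. undefined"] k p0 by (simp add: zero_ereal_def)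
    next
      case False
      then obtain s0 where "s0 \<in> S" by blast
      then show ?thesis using that[of "restrict (\<lambda>s. if s = s0 then of_int k else 0) S"] fin
        by simp
    qed
    have "p Z \<le> ereal (sum x Z)" if Z: "Z \<subseteq> S" for Z
    proof -
      consider "Z = {}" | "Z = S" | "Z \<subset> S" "Z \<noteq> {}" using Z by blast
      then show ?thesis
      proof cases
        case 3
        then have "p Z = -\<infinity>" using False by blast
        then show ?thesis by simp
      qed (use k x(3) p0 in \<open>simp_all add: zero_ereal_def\<close>)
    qed
    then have "x \<in> M_convex S p" using x k by (simp add: M_convex_iff)
    then show ?thesis by blast
  qed
qed

section \<open>The decomposition\<close>

text \<open>
  A tightening step decreases the square-sum by at least 2, so a point whose square-sum, rounded
  to a natural number, is least admits no such step at all.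
\<close>

lemma locally_balanced_exists:
  assumes fin: "finite S" and sm: "int_supermodular S p"
  shows "\<exists>z. locally_balanced S (M_convex S p) a z"
proof -
  obtain z where z: "z \<in> M_convex S p"
    and min: "\<And>y. y \<in> M_convex S p \<Longrightarrow> nat \<lfloor>square_sum S z\<rfloor> \<le> nat \<lfloor>square_sum S y\<rfloor>"
    using M_convex_nonempty[OF fin sm]
      ex_has_least_nat[of "\<lambda>x. x \<in> M_convex S p" _ "\<lambda>x. nat \<lfloor>square_sum S x\<rfloor>"] by blast
  have "exchange z s t \<notin> M_convex S p" if s: "s \<in> S" and t: "t \<in> S" and 2: "z t \<ge> z s + 2" for s t
  proof
    let ?y = "exchange z s t"
    assume y: "?y \<in> M_convex S p"
    have split: "sum f S = f s + (f t + sum f (S - {s} - {t}))" for f :: "'a \<Rightarrow> real"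
    proof -
      have "t \<in> S - {s}" using t 2 by auto
      then show ?thesis
        using sum.remove[OF fin s, of f] sum.remove[of "S - {s}" t f] fin by simp
    qed
    have "sum (\<lambda>u. (?y u)\<^sup>2) (S - {s} - {t}) = sum (\<lambda>u. (z u)\<^sup>2) (S - {s} - {t})"
      by (intro sum.cong) (auto simp: exchange_def)
    moreover have "?y s = z s + 1" "?y t = z t - 1" using 2 by (auto simp: exchange_def)
    ultimately have "square_sum S ?y = square_sum S z + 2 * (z s + 1 - z t)"
      unfolding square_sum_def split by (simp only:) (simp add: power2_eq_square algebra_simps)
    then have "square_sum S ?y \<le> square_sum S z - 2" using 2 by simp
    moreover have "0 \<le> square_sum S ?y" by (simp add: square_sum_def sum_nonneg)
    ultimately have "nat \<lfloor>square_sum S ?y\<rfloor> < nat \<lfloor>square_sum S z\<rfloor>" by linarith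
    then show False using min[OF y] by linarith
  qed
  then show ?thesis using z by (auto simp: locally_balanced_def)
qed

text \<open>
  The set P is a union of smallest tight sets and S - N an intersection of largest ones. The bounds
  on P and N come from local balance: if s is reachable from t with z(t) \<open>\<ge>\<close> a + 2 and
  z(s) \<open>\<le>\<close> a, then the exchange of s and t is one that local balance forbids, and dually for
  N. The bounds outside of P and N hold because the trivial exchange of an element with itself puts
  all elements of value at least a + 2 into P and all of value at most a - 1 into N.
\<close>

lemma locally_balanced_decomposition:
  assumes fin: "finite S" and sm: "int_supermodular S p"
    and lb: "locally_balanced S (M_convex S p) a z"
    and P: "P = S_plus S (M_convex S p) a z" and N: "N = S_minus S (M_convex S p) a z"
  shows "tight S p z P" "tight S p z (S - N)" "N \<subseteq> S" "P \<inter> N = {}"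
    and "\<And>s. s \<in> P \<Longrightarrow> of_int (a + 1) \<le> z s" "\<And>s. s \<in> N \<Longrightarrow> z s \<le> of_int a"
    and "\<And>s. s \<in> S - P \<Longrightarrow> z s \<le> of_int (a + 1)" "\<And>s. s \<in> S - N \<Longrightarrow> of_int a \<le> z s"
proof -
  have z: "z \<in> M_convex S p" using lb by (simp add: locally_balanced_def)
  have zZ: "z s \<in> \<int>" if "s \<in> S" for s using z that by (simp add: M_convex_iff)
  have ex: "z s > of_int a \<or> z t < of_int a + 1 \<or> z t < z s + 2"
    if "s \<in> S" "t \<in> S" "exchange z s t \<in> M_convex S p" for s t
    using lb that by (force simp: locally_balanced_def)
  show "tight S p z P"
    unfolding P S_plus_def using tight_exchange_sources[OF fin sm z] fin
    by (intro tight_Union[OF fin sm z]) auto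
  have "S - N = S \<inter> \<Inter>((\<lambda>s. S - {t\<in>S. exchange z s t \<in> M_convex S p}) ` {s\<in>S. z s \<le> of_int a - 1})"
    unfolding N S_minus_def by auto
  then show "tight S p z (S - N)"
    using tight_exchange_targets[OF fin sm z] fin
    by (simp only:) (intro tight_Inter[OF fin sm z]; auto)
  show "N \<subseteq> S" unfolding N S_minus_def by auto
  show Plow: "of_int (a + 1) \<le> z s" if sP: "s \<in> P" for s
  proof -
    obtain t where t: "t \<in> S" "of_int a + 2 \<le> z t" "s \<in> S" "exchange z s t \<in> M_convex S p"
      using sP unfolding P S_plus_def by auto
    then have "of_int a < z s" using ex[of s t] by auto
    then show ?thesis using Ints_less_imp_add_one_le[of "of_int a" "z s"] zZ t by simp
  qed
  show Nup: "z t \<le> of_int a" if tN: "t \<in> N" for t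
  proof (rule ccontr)
    assume "\<not> z t \<le> of_int a"
    obtain s where s: "s \<in> S" "z s \<le> of_int a - 1" "t \<in> S" "exchange z s t \<in> M_convex S p"
      using tN unfolding N S_minus_def by auto
    have "of_int a + 1 \<le> z t"
      using Ints_less_imp_add_one_le[of "of_int a" "z t"] zZ s \<open>\<not> z t \<le> of_int a\<close> by simp
    then show False using ex[of s t] s by auto
  qed
  show "P \<inter> N = {}" using Plow Nup by force
  show "z s \<le> of_int (a + 1)" if s: "s \<in> S - P" for s
  proof (rule ccontr)
    assume "\<not> z s \<le> of_int (a + 1)"
    then have "of_int (a + 1) + 1 \<le> z s" using zZ s by (intro Ints_less_imp_add_one_le) auto
    then have "s \<in> P" using s z unfolding P S_plus_def by force
    then show False using s by simp
  qed
  show "of_int a \<le> z s" if s: "s \<in> S - N" for s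
  proof (rule ccontr)
    assume "\<not> of_int a \<le> z s"
    then have "z s + 1 \<le> of_int a" using zZ s by (intro Ints_less_imp_add_one_le) auto
    then have "s \<in> N" using s z unfolding N S_minus_def by force
    then show False using s by simp
  qed
qed

lemma exchange_restrict:
  assumes "s \<in> T" "t \<in> T"
  shows "exchange (restrict x T) s t = restrict (exchange x s t) T"
  using assms by (auto simp: exchange_def fun_eq_iff)

lemma tight_exchange:
  assumes "finite S" "tight S p x Q" "s \<in> Q \<longleftrightarrow> t \<in> Q"
  shows "tight S p (exchange x s t) Q"
  using assms finite_subset[of Q S] by (auto simp: tight_def sum_exchange)

text \<open>
  The results on P and N are glued to the values of z on the remaining part one after the other,
  along the tight sets P and S - N. The bounds that z satisfies on P and N pass to the glued vector,
  because its parts there have no tightening step. A step from t to s within P or within N would be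
  a tightening step of a part. In all other cases tightness of P and S - N forces t to lie outside
  of P or s to lie in P, and t to lie in N or s to lie outside of N, so that the value at t
  exceeds the value at s by at most one.
\<close>

lemma combine_no_tightening:
  assumes fin: "finite S" and sm: "int_supermodular S p"
    and lb: "locally_balanced S (M_convex S p) a z"
    and P: "P = S_plus S (M_convex S p) a z" and N: "N = S_minus S (M_convex S p) a z"
    and ext: "x \<in> extensional S" and mid: "\<forall>s\<in>S - (P \<union> N). x s = z s"
    and xP: "restrict x P \<in> M_convex P p" and ntP: "no_tightening P (M_convex P p) (restrict x P)"
    and xN: "restrict x N \<in> M_convex N (contraction_fun S p N)"
    and ntN: "no_tightening N (M_convex N (contraction_fun S p N)) (restrict x N)"
  shows "x \<in> M_convex S p \<and> no_tightening S (M_convex S p) x"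
proof -
  note dec = locally_balanced_decomposition[OF fin sm lb P N]
  have z: "z \<in> M_convex S p" using lb by (simp add: locally_balanced_def)
  define Q where "Q = S - N"
  have PS: "P \<subseteq> S" and NQ: "N = S - Q" and QS: "Q \<subseteq> S" and PQ: "P \<subseteq> Q"
    using dec(1,3,4) by (auto simp: tight_def Q_def)
  have pP: "p P \<noteq> -\<infinity>" and pQ: "p Q \<noteq> -\<infinity>" using dec(1,2) by (auto simp: tight_def Q_def)
  have finPN: "finite P" "finite N" using fin PS dec(3) finite_subset by auto
  have zPr: "restrict z P \<in> M_convex P p" by (rule M_convex_restriction[OF z dec(1)])
  have "S - (S - N) = N" using dec(3) by auto
  then have zNr: "restrict z N \<in> M_convex N (contraction_fun S p N)"
    using M_convex_contraction[OF fin z dec(2)] by simp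

  \<comment> \<open>The intermediate vector in which only the part on P has been replaced.\<close>
  define y where "y = (\<lambda>s. if s \<in> P then x s else z s)"
  have "restrict y P = restrict x P" "restrict y (S - P) = restrict z (S - P)" "y \<in> extensional S"
    using z PS by (auto simp: y_def M_convex_iff extensional_def fun_eq_iff)
  then have y: "y \<in> M_convex S p" "tight S p y P"
    using M_convex_glue[OF fin sm PS pP, of y] xP M_convex_contraction[OF fin z dec(1)] by auto
  have sumP: "sum y P = sum z P" using y(2) dec(1) by (simp add: tight_def)
  have split: "sum w Q = sum w (Q - P) + sum w P" for w :: "'a \<Rightarrow> real"
    using sum.subset_diff[OF PQ finite_subset[OF QS fin]] .
  have "sum y (Q - P) = sum z (Q - P)" by (intro sum.cong) (auto simp: y_def)
  then have "sum y Q = sum z Q" using split[of y] split[of z] sumP by simp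
  then have "tight S p y Q" using dec(2) by (simp add: tight_def Q_def)
  then have "restrict y Q \<in> M_convex Q p" by (rule M_convex_restriction[OF y(1)])
  moreover have "restrict x Q = restrict y Q"
    using mid QS by (auto simp: y_def Q_def fun_eq_iff)
  ultimately have x: "x \<in> M_convex S p" "tight S p x Q"
    using M_convex_glue[OF fin sm QS pQ ext] xN unfolding NQ by auto
  have "sum x P = sum y P" by (intro sum.cong) (auto simp: y_def)
  then have xPt: "tight S p x P" using y(2) by (simp add: tight_def)

  have "of_int (a + 1) \<le> restrict x P s" if "s \<in> P" for s
    using no_tightening_lower_bound[OF finPN(1) int_supermodular_restriction[OF sm PS pP] xP ntP zPr,
      of "a + 1" s] dec(5) that by simp
  then have lowP: "of_int (a + 1) \<le> x s" if "s \<in> P" for s using that by force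
  have smN: "int_supermodular N (contraction_fun S p N)"
    using int_supermodular_contraction[OF sm QS pQ] unfolding NQ .
  have "restrict x N s \<le> of_int a" if "s \<in> N" for s
    using no_tightening_upper_bound[OF finPN(2) smN xN ntN zNr] dec(6) that by simp
  then have upN: "x s \<le> of_int a" if "s \<in> N" for s using that by force
  \<comment> \<open>Together with the bounds on P and N, this leaves only a and a + 1 in the middle part.\<close>
  have upQ: "x s \<le> of_int (a + 1)" if "s \<in> S - P" for s
  proof (cases "s \<in> N")
    case True
    then show ?thesis using upN[of s] by simp
  next
    case False
    then show ?thesis using mid dec(7)[OF that] that by simp
  qed
  have lowQ: "of_int a \<le> x s" if "s \<in> Q" for s
  proof (cases "s \<in> P")
    case True
    then show ?thesis using lowP[of s] by simp
  next
    case False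
    then show ?thesis using mid dec(8)[of s] that by (simp add: Q_def)
  qed

  have "exchange x s t \<notin> M_convex S p" if s: "s \<in> S" and t: "t \<in> S" and 2: "x t \<ge> x s + 2" for s t
  proof
    assume e: "exchange x s t \<in> M_convex S p"
    then have keep: "s \<in> X" if "tight S p x X" "t \<in> X" for X
      using exchange_in_M_convex_iff[OF fin sm x(1) s t] that by blast
    show False
    proof (cases "t \<in> P")
      case True
      then have sP: "s \<in> P" using keep[OF xPt] by blast
      have "restrict (exchange x s t) P \<in> M_convex P p"
        by (rule M_convex_restriction[OF e tight_exchange[OF fin xPt]]) (use True sP in simp)
      moreover have "exchange (restrict x P) s t \<notin> M_convex P p"
        using ntP True sP 2 by (simp add: no_tightening_def)
      ultimately show False using exchange_restrict[OF sP True] by simp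
    next
      case tP: False
      show False
      proof (cases "s \<in> Q")
        case True
        then have "t \<notin> N" using lowQ[of s] upN[of t] 2 by force
        then show False using True lowQ[of s] upQ[of t] tP t 2 by simp
      next
        case False
        then have "t \<notin> Q" using keep[OF x(2)] by blast
        then have stN: "s \<in> N" "t \<in> N" using False s t by (auto simp: NQ)
        have "restrict (exchange x s t) N \<in> M_convex N (contraction_fun S p N)"
          using M_convex_contraction[OF fin e tight_exchange[OF fin x(2)]] False \<open>t \<notin> Q\<close>
          by (simp add: NQ)
        moreover have "exchange (restrict x N) s t \<notin> M_convex N (contraction_fun S p N)"
          using ntN stN 2 by (simp add: no_tightening_def)
        ultimately show False using exchange_restrict[OF stN] by simp
      qed
    qed
  qed
  then show ?thesis using x(1) by (simp add: no_tightening_def)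
qed

lemma empty_M_convex:
  assumes "p {} = 0"
  shows "restrict x {} \<in> M_convex {} p"
  using assms by (simp add: M_convex_iff zero_ereal_def restrict_def)

text \<open>
  The recursive calls are only made for non-empty parts; on an empty ground set the unique vector
  has no tightening step for trivial reasons, so both cases feed into the same gluing argument.
\<close>

lemma decomposition_output_no_tightening:
  assumes "decomposition_output S p zs" "finite S" "int_supermodular S p"
  shows "zs \<in> M_convex S p \<and> no_tightening S (M_convex S p) zs"
  using assms
proof (induction rule: decomposition_output.induct)
  case (decompose M S p a z Sp Sm zs)
  note fin = \<open>finite S\<close> and sm = \<open>int_supermodular S p\<close>
  have lb: "locally_balanced S (M_convex S p) a z"
    and P: "Sp = S_plus S (M_convex S p) a z" and N: "Sm = S_minus S (M_convex S p) a z"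
    using decompose.hyps by simp_all
  note dec = locally_balanced_decomposition[OF fin sm lb P N]
  have PS: "Sp \<subseteq> S" "p Sp \<noteq> -\<infinity>" and Q: "p (S - Sm) \<noteq> -\<infinity>"
    using dec(1,2) by (auto simp: tight_def)
  have NQ: "S - (S - Sm) = Sm" using dec(3) by auto
  have smP: "int_supermodular Sp p" by (rule int_supermodular_restriction[OF sm PS])
  have smN: "int_supermodular Sm (contraction_fun S p Sm)"
    using int_supermodular_contraction[OF sm _ Q] NQ by simp
  have fin': "finite Sp" "finite Sm" using fin PS dec(3) finite_subset by auto
  have "restrict zs Sp \<in> M_convex Sp p \<and> no_tightening Sp (M_convex Sp p) (restrict zs Sp)"
  proof (cases "Sp = {}")
    case True
    then show ?thesis using empty_M_convex[of p zs] sm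
      by (simp add: no_tightening_def int_supermodular_def)
  qed (use decompose smP fin' in blast)
  moreover have "restrict zs Sm \<in> M_convex Sm (contraction_fun S p Sm) \<and>
    no_tightening Sm (M_convex Sm (contraction_fun S p Sm)) (restrict zs Sm)"
  proof (cases "Sm = {}")
    case True
    then show ?thesis using empty_M_convex[of "contraction_fun S p {}" zs] smN
      by (simp add: no_tightening_def int_supermodular_def)
  qed (use decompose smN fin' in blast)
  ultimately show ?case
    using combine_no_tightening[OF fin sm lb P N] decompose.hyps by blast
qed

lemma avg_floor_bounds:
  assumes fin: "finite S" and "S \<noteq> {}" and z: "z \<in> M_convex S p"
  shows "of_int (avg_floor S p) * real (card S) \<le> sum z S"
    and "sum z S < of_int (avg_floor S p + 1) * real (card S)"
proof -
  have pos: "real (card S) > 0" using assms by (simp add: card_gt_0_iff)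
  have "avg_floor S p = \<lfloor>sum z S / real (card S)\<rfloor>"
    using z by (simp add: avg_floor_def M_convex_iff)
  then have "of_int (avg_floor S p) \<le> sum z S / real (card S)"
    "sum z S / real (card S) < of_int (avg_floor S p + 1)"
    by linarith+
  then show "of_int (avg_floor S p) * real (card S) \<le> sum z S"
    "sum z S < of_int (avg_floor S p + 1) * real (card S)"
    using pos by (simp_all add: pos_le_divide_eq pos_divide_less_eq)
qed

text \<open>
  This is where the choice of a matters. Values of at least a + 1 everywhere would exceed the
  average, and if \<open>S_minus\<close> is everything, the values are at most a everywhere and below a
  somewhere, which falls short of it.
\<close>

lemma S_plus_S_minus_proper:
  assumes fin: "finite S" and ne: "S \<noteq> {}" and sm: "int_supermodular S p"
    and lb: "locally_balanced S (M_convex S p) (avg_floor S p) z"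
  shows "S_plus S (M_convex S p) (avg_floor S p) z \<noteq> S"
    and "S_minus S (M_convex S p) (avg_floor S p) z \<noteq> S"
proof -
  let ?a = "avg_floor S p"
  note dec = locally_balanced_decomposition[OF fin sm lb refl refl]
  have z: "z \<in> M_convex S p" using lb by (simp add: locally_balanced_def)
  note bounds = avg_floor_bounds[OF fin ne z]
  show "S_plus S (M_convex S p) ?a z \<noteq> S"
  proof
    assume "S_plus S (M_convex S p) ?a z = S"
    then have "(\<Sum>s\<in>S. of_int (?a + 1)) \<le> sum z S" using dec(5) by (intro sum_mono) auto
    then show False using bounds(2) by (simp add: mult.commute)
  qed
  show "S_minus S (M_convex S p) ?a z \<noteq> S"
  proof
    assume eq: "S_minus S (M_convex S p) ?a z = S"
    then obtain s where "s \<in> S" "z s \<le> of_int ?a - 1"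
      using ne unfolding S_minus_def by blast
    then have "sum z S < (\<Sum>s\<in>S. of_int ?a)"
      using fin dec(6) eq by (intro sum_strict_mono_ex1) force+
    then show False using bounds(1) by (simp add: mult.commute)
  qed
qed

lemma decomposition_output_exists:
  assumes "finite S" "S \<noteq> {}" "int_supermodular S p"
  shows "\<exists>zs. decomposition_output S p zs"
  using assms
proof (induction "card S" arbitrary: S p rule: less_induct)
  case less
  note fin = \<open>finite S\<close> and ne = \<open>S \<noteq> {}\<close> and sm = \<open>int_supermodular S p\<close>
  define a where "a = avg_floor S p"
  obtain z where lb: "locally_balanced S (M_convex S p) a z"
    using locally_balanced_exists[OF fin sm] by blast
  define P where "P = S_plus S (M_convex S p) a z"
  define N where "N = S_minus S (M_convex S p) a z"
  note dec = locally_balanced_decomposition[OF fin sm lb P_def N_def]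
  have PS: "P \<subseteq> S" "p P \<noteq> -\<infinity>" and Q: "p (S - N) \<noteq> -\<infinity>"
    using dec(1,2) by (auto simp: tight_def)
  have NQ: "S - (S - N) = N" using dec(3) by auto
  have fin': "finite P" "finite N" using fin PS dec(3) finite_subset by auto
  have ltP: "card P < card S" and ltN: "card N < card S"
    using S_plus_S_minus_proper[OF fin ne sm lb[unfolded a_def]] PS dec(3) fin
    by (auto simp: P_def N_def a_def intro!: psubset_card_mono)
  obtain x where x: "P \<noteq> {} \<longrightarrow> decomposition_output P p x"
    using less.hyps[OF ltP fin'(1)] int_supermodular_restriction[OF sm PS] by blast
  have smN: "int_supermodular N (contraction_fun S p N)"
    using int_supermodular_contraction[OF sm _ Q] NQ by simp
  obtain y where y: "N \<noteq> {} \<longrightarrow> decomposition_output N (contraction_fun S p N) y"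
    using less.hyps[OF ltN fin'(2)] smN by blast
  define zs where "zs = restrict (\<lambda>s. if s \<in> P then x s else if s \<in> N then y s else z s) S"
  have ext: "w \<in> extensional T" if "decomposition_output T q w" for T q and w :: "'a \<Rightarrow> real"
    using that by cases
  have "restrict zs P = x" if "P \<noteq> {}"
    using ext x that PS by (fastforce simp: zs_def extensional_def fun_eq_iff)
  moreover have "restrict zs N = y" if "N \<noteq> {}"
    using ext y that dec(3,4) by (fastforce simp: zs_def extensional_def fun_eq_iff)
  moreover have "\<forall>s\<in>S - (P \<union> N). zs s = z s" "zs \<in> extensional S" by (auto simp: zs_def)
  ultimately have "decomposition_output S p zs"
    using x y by (intro decomposition_output.decompose[OF refl a_def lb P_def N_def]) auto
  then show ?case by blast
qed

theorem proposition5p7: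
  fixes S :: "'a set" and p :: "'a set \<Rightarrow> ereal"
  assumes "finite S" and "S \<noteq> {}"
    and "int_supermodular S p"
  shows "(\<exists>zs. decomposition_output S p zs) \<and>
    (\<forall>zs. decomposition_output S p zs \<longrightarrow>
       is_arg_min (square_sum S) (\<lambda>x. x \<in> int_points S (base_polyhedron S p)) zs \<and>
       dec_min S (int_points S (base_polyhedron S p)) zs)"
  using decomposition_output_exists[OF assms] no_tightening_optimal[OF assms(1,3)]
    decomposition_output_no_tightening[OF _ assms(1,3)]
  by blast

end
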